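(* Let $\{M_i\}_{i=1}^k$ be a family of species of structures ($k\ge1$) whose exponential generating series $M_i(x)=F_i(x+1)$ are given expressed as power series of $(x+1)$, $$M_i(x)=F_i(x+1)=\sum_{n\ge0}b_n^{(i)}\frac{(x+1)^n}{n!},\qquad i=1,\dots,k.$$ Then $$(\widetilde{\boxdot}_{i=1}^kM_i)(x)=\sum_{n\ge0}\left(\sum_{i_1,i_2,\dots,i_k\ge0}b_{i_1}^{(1)}\cdots b_{i_k}^{(k)}\frac{(i_1\cdots i_k)_n}{i_1!\,i_2!\cdots i_k!}\right)\frac{x^n}{n!}$$ $$\qquad=a_0+\sum_{n\ge1}\left(\sum_{l\ge n}\frac{1}{(l-n)!}\left[\frac{x^l}{l!}\right](F_1\boxdot\cdots\boxdot F_k)(x)\right)\frac{x^n}{n!},$$ where $a_0=|(\widetilde{\boxdot}_{i=1}^kM_i)[\varnothing]|=\prod_{i=1}^k|M_i[\varnothing]|$.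
   Context: A species of structures is a functor $F$ from the category of finite sets and bijections to itself; $F[U]$ is the finite set of $F$-structures on $U$, $F[n]$ abbreviates $F[\{1,\dots,n\}]$, and the exponential generating series is $F(x)=\sum_{n\ge0}|F[n]|\,x^n/n!$. A $k$-partial rectangle on a finite set $U$ is a tuple $(\pi_1,\dots,\pi_k)$ of set partitions of $U$ with $\pi_1\wedge\cdots\wedge\pi_k=\hat0$ (the partition into singletons). $P_{\mathcal{R}}^{(k)}[U]$ is the set of these. The modified arithmetic product is $(\widetilde{\boxdot}_{i=1}^kM_i)[U]=\sum_{(\pi_1,\dots,\pi_k)\in P_{\mathcal{R}}^{(k)}[U]}\prod_{i=1}^kM_i[\pi_i]$ (disjoint union), where each $\pi_i$ is regarded as a finite set of blocks. The expansion of $M_i(x)$ in powers of $(x+1)$, with numerical coefficients $b_n^{(i)}$, means that re-expanding in powers of $x$ gives convergent series with the correct coefficients: for every $j\ge0$, $\sum_{n\ge0}b_n^{(i)}\frac{(n)_j}{n!}$ converges to $|M_i[j]|$. Here $(m)_n=m(m-1)\cdots(m-n+1)$, $(m)_0=1$. $F_i(x)=\sum_{n\ge0}b^{(i)}_nx^n/n!$ is regarded as a series in $x$, and $\boxdot$ is the arithmetic product of power series, $x^n\boxdot x^m=x^{nm}$, extended (bi)linearly, so that for $l\ge1$ the coefficient of $x^l/l!$ (only terms of positive degree of the $F_i$ are involved) is $$\left[\frac{x^l}{l!}\right](F_1\boxdot\cdots\boxdot F_k)(x)=\sum_{d_1d_2\cdots d_k=l}\frac{l!}{d_1!\cdots d_k!}\,b^{(1)}_{d_1}\cdots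 b^{(k)}_{d_k},$$ the sum over $k$-tuples of positive integers with product $l$. *)

theory Defs
  imports
    "HOL-Analysis.Analysis"
    "HOL-Library.FSet"
    "HOL-Library.Disjoint_Sets"
    "HOL-Computational_Algebra.Formal_Power_Series"
begin

text \<open>Species are evaluated both on a finite set \<open>U\<close> and on set partitions of \<open>U\<close>, whose elements
  are finite subsets of \<open>U\<close>. A type of labels closed under forming finite sets of labels makes this
  possible within one type: every finite set is in bijection with a finite set of labels, so the
  finite sets of labels with the bijections between them form a category equivalent to that of all
  finite sets with bijections.\<close>

datatype label = Atom nat | Block "label fset"

text \<open>A species with structures of type \<open>'s\<close>. For a bijection \<open>\<sigma>\<close> from \<open>U\<close> to \<open>V\<close>,
  \<open>transport F U \<sigma>\<close> is the induced map from \<open>structs F U\<close> to \<open>structs F V\<close>. Since \<open>\<sigma>\<close> is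
  a total function, functoriality includes independence of its values outside \<open>U\<close>.\<close>

record 's species =
  structs :: "label set \<Rightarrow> 's set"
  transport :: "label set \<Rightarrow> (label \<Rightarrow> label) \<Rightarrow> 's \<Rightarrow> 's"

definition is_species :: "'s species \<Rightarrow> bool" where
  "is_species F \<longleftrightarrow>
     (\<forall>U. finite U \<longrightarrow> finite (structs F U)) \<and>
     (\<forall>U V \<sigma>. finite U \<longrightarrow> bij_betw \<sigma> U V \<longrightarrow>
        bij_betw (transport F U \<sigma>) (structs F U) (structs F V)) \<and>
     (\<forall>U. finite U \<longrightarrow> (\<forall>s \<in> structs F U. transport F U id s = s)) \<and>
     (\<forall>U V W \<sigma> \<tau>. finite U \<longrightarrow> bij_betw \<sigma> U V \<longrightarrow> bij_betw \<tau> V W \<longrightarrow>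
        (\<forall>s \<in> structs F U. transport F U (\<tau> \<circ> \<sigma>) s = transport F V \<tau> (transport F U \<sigma> s))) \<and>
     (\<forall>U V \<sigma> \<sigma>'. finite U \<longrightarrow> bij_betw \<sigma> U V \<longrightarrow> (\<forall>u \<in> U. \<sigma> u = \<sigma>' u) \<longrightarrow>
        (\<forall>s \<in> structs F U. transport F U \<sigma> s = transport F U \<sigma>' s))"

definition initial_labels :: "nat \<Rightarrow> label set" where
  "initial_labels n = Atom ` {1..n}"

definition egf :: "'s species \<Rightarrow> 'c::field_char_0 fps" where
  "egf F = Abs_fps (\<lambda>n. of_nat (card (structs F (initial_labels n))) / fact n)"

text \<open>\<open>common_refinement\<close> of a set of partitions of \<open>U\<close> is their meet in the lattice of
  partitions ordered by refinement, and \<open>{{u} | u \<in> U}\<close> is the least partition.\<close>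

definition partial_rectangles :: "nat \<Rightarrow> 'a set \<Rightarrow> (nat \<Rightarrow> 'a set set) set" where
  "partial_rectangles k U =
     {\<pi> \<in> {1..k} \<rightarrow>\<^sub>E {P. partition_on U P}. common_refinement (\<pi> ` {1..k}) = (\<lambda>u. {u}) ` U}"

text \<open>A set partition regarded as a finite set of labels, one for each block.\<close>

definition block_labels :: "label set set \<Rightarrow> label set" where
  "block_labels P = (\<lambda>B. Block (Abs_fset B)) ` P"

fun relabel_block :: "(label \<Rightarrow> label) \<Rightarrow> label \<Rightarrow> label" where
  "relabel_block \<sigma> (Block B) = Block (\<sigma> |`| B)"
| "relabel_block \<sigma> (Atom n) = Atom n"

definition mod_arith_prod ::
    "nat \<Rightarrow> (nat \<Rightarrow> 's species) \<Rightarrow> ((nat \<Rightarrow> label set set) \<times> (nat \<Rightarrow> 's)) species" where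
  "mod_arith_prod k M =
     \<lparr>structs = (\<lambda>U. SIGMA \<pi> : partial_rectangles k U.
                       \<Pi>\<^sub>E i\<in>{1..k}. structs (M i) (block_labels (\<pi> i))),
      transport = (\<lambda>U \<sigma> (\<pi>, s).
        ((\<lambda>i\<in>{1..k}. (`) \<sigma> ` \<pi> i),
         (\<lambda>i\<in>{1..k}. transport (M i) (block_labels (\<pi> i)) (relabel_block \<sigma>) (s i))))\<rparr>"

lemma is_speciesI:
  assumes fin: "\<And>U. finite U \<Longrightarrow> finite (structs F U)"
    and maps: "\<And>U V \<sigma> s. finite U \<Longrightarrow> bij_betw \<sigma> U V \<Longrightarrow> s \<in> structs F U \<Longrightarrow> transport F U \<sigma> s \<in> structs F V"
    and ident: "\<And>U s. finite U \<Longrightarrow> s \<in> structs F U \<Longrightarrow> transport F U id s = s"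
    and comp: "\<And>U V W \<sigma> \<tau> s. finite U \<Longrightarrow> bij_betw \<sigma> U V \<Longrightarrow> bij_betw \<tau> V W \<Longrightarrow> s \<in> structs F U \<Longrightarrow>
        transport F U (\<tau> \<circ> \<sigma>) s = transport F V \<tau> (transport F U \<sigma> s)"
    and local: "\<And>U V \<sigma> \<sigma>' s. finite U \<Longrightarrow> bij_betw \<sigma> U V \<Longrightarrow> (\<forall>u \<in> U. \<sigma> u = \<sigma>' u) \<Longrightarrow> s \<in> structs F U \<Longrightarrow>
        transport F U \<sigma> s = transport F U \<sigma>' s"
  shows "is_species F"
proof -
  have inverse: "transport F V \<tau> (transport F U \<sigma> s) = s"
    if "finite U" "bij_betw \<sigma> U V" "bij_betw \<tau> V U" "\<forall>u\<in>U. \<tau> (\<sigma> u) = u" "s \<in> structs F U"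
    for U V \<sigma> \<tau> s
  proof -
    have "bij_betw (\<tau> \<circ> \<sigma>) U U" using that by (metis bij_betw_trans)
    then have "transport F U (\<tau> \<circ> \<sigma>) s = transport F U id s"
      using that by (intro local[of U "\<tau> \<circ> \<sigma>" U]) auto
    then show ?thesis
      using comp[OF that(1,2,3,5)] ident[OF that(1,5)] by simp
  qed
  have "bij_betw (transport F U \<sigma>) (structs F U) (structs F V)"
    if U: "finite U" and \<sigma>: "bij_betw \<sigma> U V" for U V \<sigma>
  proof (rule bij_betw_byWitness[where f' = "transport F V (inv_into U \<sigma>)"])
    have V: "finite V" using U \<sigma> bij_betw_finite by blast
    have \<tau>: "bij_betw (inv_into U \<sigma>) V U" using \<sigma> by (rule bij_betw_inv_into)
    show "\<forall>s\<in>structs F U. transport F V (inv_into U \<sigma>) (transport F U \<sigma> s) = s"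
      using inverse[OF U \<sigma> \<tau>] bij_betw_inv_into_left[OF \<sigma>] by blast
    show "\<forall>s\<in>structs F V. transport F U \<sigma> (transport F V (inv_into U \<sigma>) s) = s"
      using inverse[OF V \<tau> \<sigma>] bij_betw_inv_into_right[OF \<sigma>] by blast
    show "transport F U \<sigma> ` structs F U \<subseteq> structs F V" using maps U \<sigma> by blast
    show "transport F V (inv_into U \<sigma>) ` structs F V \<subseteq> structs F U" using maps V \<tau> by blast
  qed
  then show ?thesis
    unfolding is_species_def
    apply (intro conjI allI impI ballI)
        apply (erule fin)
       apply assumption
      apply (erule (1) ident)
     apply (erule (3) comp)
    apply (erule (3) local)
    done
qed

lemma is_speciesD:
  assumes "is_species F" "finite U"
  shows is_species_finite: "finite (structs F U)"
    and is_species_bij: "bij_betw \<sigma> U V \<Longrightarrow> bij_betw (transport F U \<sigma>) (structs F U) (structs F V)"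
    and is_species_id: "s \<in> structs F U \<Longrightarrow> transport F U id s = s"
    and is_species_comp: "bij_betw \<sigma> U V \<Longrightarrow> bij_betw \<tau> V W \<Longrightarrow> s \<in> structs F U \<Longrightarrow>
          transport F U (\<tau> \<circ> \<sigma>) s = transport F V \<tau> (transport F U \<sigma> s)"
    and is_species_local: "bij_betw \<sigma> U V \<Longrightarrow> \<forall>u\<in>U. \<sigma> u = \<sigma>' u \<Longrightarrow> s \<in> structs F U \<Longrightarrow>
          transport F U \<sigma> s = transport F U \<sigma>' s"
  using assms unfolding is_species_def by simp_all

lemma common_refinement_singletons_iff:
  fixes k :: nat
  assumes "k \<ge> 1" and \<pi>: "\<And>i. i \<in> {1..k} \<Longrightarrow> partition_on U (\<pi> i)"
  shows "common_refinement (\<pi> ` {1..k}) = (\<lambda>u. {u}) ` U \<longleftrightarrow>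
         (\<forall>x\<in>U. \<forall>y\<in>U. (\<forall>i\<in>{1..k}. \<exists>B\<in>\<pi> i. x \<in> B \<and> y \<in> B) \<longrightarrow> x = y)"
    (is "?L \<longleftrightarrow> ?R")
proof -
  have part: "partition_on U (common_refinement (\<pi> ` {1..k}))"
    by (rule partition_on_common_refinement) (use assms in auto)
  have together: "(\<exists>C\<in>common_refinement (\<pi> ` {1..k}). x \<in> C \<and> y \<in> C) \<longleftrightarrow>
      (\<forall>i\<in>{1..k}. \<exists>B\<in>\<pi> i. x \<in> B \<and> y \<in> B)" (is "?A \<longleftrightarrow> ?B") for x y
  proof
    assume ?A then show ?B
    proof (intro ballI)
      fix i assume i: "i \<in> {1..k}"
      from \<open>?A\<close> obtain C where C: "C \<in> common_refinement (\<pi> ` {1..k})" "x \<in> C" "y \<in> C" by blast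
      obtain B where "B \<in> \<pi> i" "C \<subseteq> B"
        using common_refinement_exists[OF C(1) imageI[OF i]] by blast
      then show "\<exists>B\<in>\<pi> i. x \<in> B \<and> y \<in> B" using C by blast
    qed
  next
    assume ?B
    then have "\<forall>P\<in>\<pi> ` {1..k}. \<exists>B\<in>P. x \<in> B \<and> y \<in> B" by blast
    then obtain f where f: "\<And>P. P \<in> \<pi> ` {1..k} \<Longrightarrow> f P \<in> P \<and> x \<in> f P \<and> y \<in> f P"
      by metis
    then have xy: "x \<in> \<Inter> (f ` \<pi> ` {1..k})" "y \<in> \<Inter> (f ` \<pi> ` {1..k})" by blast+
    have "\<Inter> (f ` \<pi> ` {1..k}) \<in> common_refinement (\<pi> ` {1..k})"
      unfolding common_refinement
    proof (intro DiffI UN_I)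
      show "f \<in> (\<Pi> P\<in>\<pi> ` {1..k}. P)" using f by (intro Pi_I) blast
      show "\<Inter> (f ` \<pi> ` {1..k}) \<in> {\<Inter> (f ` \<pi> ` {1..k})}" by (rule singletonI)
      show "\<Inter> (f ` \<pi> ` {1..k}) \<notin> {{}}" using xy(1) by blast
    qed
    then show ?A using xy by (intro bexI[where x = "\<Inter> (f ` \<pi> ` {1..k})"] conjI)
  qed
  show ?thesis
  proof
    assume ?L
    then show ?R unfolding together[symmetric] by auto
  next
    assume ?R
    have single: "x = y" if C: "C \<in> common_refinement (\<pi> ` {1..k})" "x \<in> C" "y \<in> C" for C x y
    proof -
      have "x \<in> U" "y \<in> U" using C partition_onD1[OF part] by auto
      moreover have "\<forall>i\<in>{1..k}. \<exists>B\<in>\<pi> i. x \<in> B \<and> y \<in> B"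
        using C iffD1[OF together, of x y] by blast
      ultimately show ?thesis using \<open>?R\<close> by simp
    qed
    have "C \<in> (\<lambda>u. {u}) ` U" if C: "C \<in> common_refinement (\<pi> ` {1..k})" for C
    proof -
      obtain x where "x \<in> C" using part C by (metis all_not_in_conv partition_onD3)
      then have "C = {x}" using single[OF C] by auto
      moreover have "x \<in> U" using \<open>x \<in> C\<close> C partition_onD1[OF part] by auto
      ultimately show ?thesis by simp
    qed
    moreover have "{u} \<in> common_refinement (\<pi> ` {1..k})" if "u \<in> U" for u
    proof -
      obtain C where C: "C \<in> common_refinement (\<pi> ` {1..k})" "u \<in> C"
        using \<open>u \<in> U\<close> partition_onD1[OF part] by auto
      then have "C = {u}" using single[OF C(1)] by auto
      then show ?thesis using C by simp
    qed
    ultimately show ?L by blast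
  qed
qed

lemma partition_on_image:
  assumes "partition_on U P" "bij_betw \<sigma> U V"
  shows "partition_on V ((`) \<sigma> ` P)"
proof -
  have "partition_on (\<sigma> ` U) ((`) \<sigma> ` P - {{}})"
    using assms by (intro partition_on_inj_image) (auto simp: bij_betw_def)
  moreover have "(`) \<sigma> ` P - {{}} = (`) \<sigma> ` P"
    using partition_onD3[OF assms(1)] by auto
  ultimately show ?thesis using assms(2) by (simp add: bij_betw_def)
qed

lemma partial_rectangles_image:
  assumes "k \<ge> 1" "bij_betw \<sigma> U V" "\<pi> \<in> partial_rectangles k U"
  shows "(\<lambda>i\<in>{1..k}. (`) \<sigma> ` \<pi> i) \<in> partial_rectangles k V"
proof -
  have \<pi>: "partition_on U (\<pi> i)" if "i \<in> {1..k}" for i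
    using assms(3) that by (auto simp: partial_rectangles_def)
  have sep: "x = y" if "x \<in> U" "y \<in> U" "\<forall>i\<in>{1..k}. \<exists>B\<in>\<pi> i. x \<in> B \<and> y \<in> B" for x y
    using assms(1,3) \<pi> that common_refinement_singletons_iff[of k U \<pi>]
    by (simp add: partial_rectangles_def)
  let ?\<pi>' = "\<lambda>i\<in>{1..k}. (`) \<sigma> ` \<pi> i"
  have \<pi>': "partition_on V (?\<pi>' i)" if "i \<in> {1..k}" for i
    using partition_on_image[OF \<pi>[OF that] assms(2)] that by simp
  have "x = y" if x: "x \<in> V" and y: "y \<in> V" and tog: "\<forall>i\<in>{1..k}. \<exists>B\<in>?\<pi>' i. x \<in> B \<and> y \<in> B" for x y
  proof -
    obtain u v where u: "u \<in> U" "x = \<sigma> u" and v: "v \<in> U" "y = \<sigma> v"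
      using x y assms(2) by (auto simp: bij_betw_def)
    have "\<exists>B\<in>\<pi> i. u \<in> B \<and> v \<in> B" if i: "i \<in> {1..k}" for i
    proof -
      obtain B where B: "B \<in> \<pi> i" "\<sigma> u \<in> \<sigma> ` B" "\<sigma> v \<in> \<sigma> ` B"
        using bspec[OF tog i] i u v by auto
      moreover have "B \<subseteq> U" using B(1) partition_onD1[OF \<pi>[OF i]] by blast
      ultimately show ?thesis
        using u v assms(2) by (metis bij_betw_def inj_on_image_mem_iff)
    qed
    then show ?thesis using sep u v by blast
  qed
  then have "common_refinement (?\<pi>' ` {1..k}) = (\<lambda>u. {u}) ` V"
    using iffD2[OF common_refinement_singletons_iff[where \<pi> = ?\<pi>', OF assms(1) \<pi>']] by blast
  then show ?thesis using \<pi>' by (auto simp: partial_rectangles_def)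
qed

lemma relabel_block_Abs_fset:
  "finite B \<Longrightarrow> relabel_block \<sigma> (Block (Abs_fset B)) = Block (Abs_fset (\<sigma> ` B))"
  by (simp add: fimage.abs_eq eq_onp_same_args)

lemma bij_betw_relabel_block:
  assumes "finite U" "bij_betw \<sigma> U V" "partition_on U P"
  shows "bij_betw (relabel_block \<sigma>) (block_labels P) (block_labels ((`) \<sigma> ` P))"
proof -
  have sub: "B \<subseteq> U" "finite B" if "B \<in> P" for B
  proof -
    show "B \<subseteq> U" using that partition_onD1[OF assms(3)] by auto
    then show "finite B" using assms(1) by (rule finite_subset)
  qed
  have "relabel_block \<sigma> ` block_labels P = block_labels ((`) \<sigma> ` P)"
    unfolding block_labels_def image_image
    by (rule image_cong) (use sub relabel_block_Abs_fset in auto)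
  moreover have "inj_on (relabel_block \<sigma>) (block_labels P)"
  proof (rule inj_onI)
    fix x y assume "x \<in> block_labels P" "y \<in> block_labels P" and eq: "relabel_block \<sigma> x = relabel_block \<sigma> y"
    then obtain A B where A: "A \<in> P" "x = Block (Abs_fset A)" and B: "B \<in> P" "y = Block (Abs_fset B)"
      unfolding block_labels_def by blast
    then have "\<sigma> ` A = \<sigma> ` B"
      using eq sub by (simp add: relabel_block_Abs_fset Abs_fset_inject del: relabel_block.simps)
    then show "x = y"
      using A B inj_on_image_eq_iff[OF bij_betw_imp_inj_on[OF assms(2)] sub(1) sub(1)] by simp
  qed
  ultimately show ?thesis by (simp add: bij_betw_def)
qed

lemma relabel_block_id: "relabel_block id = id"
proof
  show "relabel_block id x = id x" for x by (cases x) simp_all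
qed

lemma relabel_block_comp: "relabel_block (\<tau> \<circ> \<sigma>) = relabel_block \<tau> \<circ> relabel_block \<sigma>"
proof
  show "relabel_block (\<tau> \<circ> \<sigma>) x = (relabel_block \<tau> \<circ> relabel_block \<sigma>) x" for x
    by (cases x) (simp_all add: fset.map_comp)
qed

theorem is_species_mod_arith_prod:
  assumes k: "k \<ge> 1" and M: "\<And>i. i \<in> {1..k} \<Longrightarrow> is_species (M i)"
  shows "is_species (mod_arith_prod k M)"
proof (rule is_speciesI)
  note M_fin = is_species_finite[OF M]
    and M_maps = bij_betwE[OF is_species_bij[OF M], rule_format]
    and M_id = is_species_id[OF M]
    and M_comp = is_species_comp[OF M]
    and M_local = is_species_local[OF M]
  have part: "partition_on U (\<pi> i)"
    if "finite U" "\<pi> \<in> partial_rectangles k U" "i \<in> {1..k}" for \<pi> U i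
    using that PiE_mem by (fastforce simp: partial_rectangles_def)
  have fin_bl: "finite (block_labels (\<pi> i))"
    if "finite U" "\<pi> \<in> partial_rectangles k U" "i \<in> {1..k}" for \<pi> U i
    using finite_elements[OF that(1) part[OF that]] by (simp add: block_labels_def)

  fix U :: "label set" assume U: "finite U"
  have "partial_rectangles k U \<subseteq> {1..k} \<rightarrow>\<^sub>E {P. partition_on U P}"
    by (auto simp: partial_rectangles_def)
  then have "finite (partial_rectangles k U)"
    by (rule finite_subset) (intro finite_PiE finitely_many_partition_on U finite_atLeastAtMost)
  then show "finite (structs (mod_arith_prod k M) U)"
    using fin_bl[OF U] M_fin
    by (auto simp: mod_arith_prod_def intro!: finite_SigmaI finite_PiE)

  fix x assume x: "x \<in> structs (mod_arith_prod k M) U"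
  obtain \<pi> s where x_eq: "x = (\<pi>, s)" by (cases x)
  have \<pi>: "\<pi> \<in> partial_rectangles k U"
    and s: "s \<in> (\<Pi>\<^sub>E i\<in>{1..k}. structs (M i) (block_labels (\<pi> i)))"
    using x by (auto simp: mod_arith_prod_def x_eq)
  have \<pi>_ext: "\<pi> \<in> extensional {1..k}" using \<pi> by (auto simp: partial_rectangles_def PiE_def)
  have s_ext: "s \<in> extensional {1..k}" using s by (auto simp: PiE_def)
  have s_mem: "s i \<in> structs (M i) (block_labels (\<pi> i))" if "i \<in> {1..k}" for i
    using s that by (rule PiE_mem)
  note bl = part[OF U \<pi>] fin_bl[OF U \<pi>]

  show "transport (mod_arith_prod k M) U id x = x"
    using M_id[OF _ bl(2) s_mem] \<pi>_ext s_ext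
    by (auto simp: mod_arith_prod_def x_eq relabel_block_id intro!: extensionalityI[of _ "{1..k}"])

  fix V :: "label set" and \<sigma> assume \<sigma>: "bij_betw \<sigma> U V"
  have b\<sigma>: "bij_betw (relabel_block \<sigma>) (block_labels (\<pi> i)) (block_labels ((`) \<sigma> ` \<pi> i))"
    if "i \<in> {1..k}" for i
    using bij_betw_relabel_block[OF U \<sigma> bl(1)[OF that]] .
  show "transport (mod_arith_prod k M) U \<sigma> x \<in> structs (mod_arith_prod k M) V"
    using partial_rectangles_image[OF k \<sigma> \<pi>] M_maps[OF _ bl(2) b\<sigma> s_mem]
    by (auto simp: mod_arith_prod_def x_eq)

  { fix \<sigma>' :: "label \<Rightarrow> label" assume eq: "\<forall>u\<in>U. \<sigma> u = \<sigma>' u"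
    have im: "\<sigma> ` B = \<sigma>' ` B" if "i \<in> {1..k}" "B \<in> \<pi> i" for i B
    proof (rule image_cong)
      show "\<sigma> u = \<sigma>' u" if "u \<in> B" for u
        using that eq partition_onD1[OF bl(1)[OF \<open>i \<in> {1..k}\<close>]] \<open>B \<in> \<pi> i\<close> by blast
    qed simp
    have "relabel_block \<sigma> z = relabel_block \<sigma>' z" if i: "i \<in> {1..k}" and z: "z \<in> block_labels (\<pi> i)" for i z
    proof -
      obtain B where B: "B \<in> \<pi> i" "z = Block (Abs_fset B)"
        using z by (auto simp: block_labels_def)
      then have "finite B"
        using U partition_onD1[OF bl(1)[OF i]] by (metis Sup_upper finite_subset)
      then show ?thesis using B im[OF i] by (simp add: relabel_block_Abs_fset del: relabel_block.simps)
    qed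
    then have "transport (M i) (block_labels (\<pi> i)) (relabel_block \<sigma>) (s i) =
        transport (M i) (block_labels (\<pi> i)) (relabel_block \<sigma>') (s i)" if "i \<in> {1..k}" for i
      using M_local[OF that bl(2)[OF that] b\<sigma>[OF that]] s_mem that by metis
    moreover have "(`) \<sigma> ` \<pi> i = (`) \<sigma>' ` \<pi> i" if "i \<in> {1..k}" for i
      by (rule image_cong) (use im[OF that] in auto)
    ultimately show "transport (mod_arith_prod k M) U \<sigma> x = transport (mod_arith_prod k M) U \<sigma>' x"
      by (simp add: mod_arith_prod_def x_eq cong: restrict_cong) }

  fix W :: "label set" and \<tau> assume \<tau>: "bij_betw \<tau> V W"
  have V: "finite V" using U \<sigma> bij_betw_finite by blast
  have b\<tau>: "bij_betw (relabel_block \<tau>) (block_labels ((`) \<sigma> ` \<pi> i)) (block_labels ((`) \<tau> ` (`) \<sigma> ` \<pi> i))"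
    if "i \<in> {1..k}" for i
    using bij_betw_relabel_block[OF V \<tau> partition_on_image[OF bl(1)[OF that] \<sigma>]] .
  have "(`) (\<tau> \<circ> \<sigma>) ` \<pi> i = (`) \<tau> ` (`) \<sigma> ` \<pi> i" for i
    by (simp add: image_image image_comp)
  then show "transport (mod_arith_prod k M) U (\<tau> \<circ> \<sigma>) x =
      transport (mod_arith_prod k M) V \<tau> (transport (mod_arith_prod k M) U \<sigma> x)"
    using M_comp[OF _ bl(2) b\<sigma> b\<tau> s_mem]
    by (simp add: mod_arith_prod_def x_eq relabel_block_comp cong: restrict_cong)
qed

text \<open>The falling factorial \<open>(x)\<^sub>n\<close>.\<close>

definition falling :: "'c::comm_ring_1 \<Rightarrow> nat \<Rightarrow> 'c" where
  "falling x n = (\<Prod>i<n. x - of_nat i)"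

text \<open>\<open>F(x) = \<Sum>n. b n (x + 1)^n / n!\<close>, in the sense that expanding the powers of \<open>x + 1\<close> gives
  series converging to the coefficients of \<open>F(x)\<close>; note that the coefficient of \<open>x^j / j!\<close> in
  \<open>(x + 1)^n\<close> is \<open>falling n j\<close>.\<close>

definition expands_at_succ ::
    "'s species \<Rightarrow> (nat \<Rightarrow> 'c::real_normed_field) \<Rightarrow> bool" where
  "expands_at_succ F b \<longleftrightarrow>
     (\<forall>j. (\<lambda>n. b n * falling (of_nat n) j / fact n) sums
            of_nat (card (structs F (initial_labels j))))"

definition exp_series :: "(nat \<Rightarrow> 'c::field_char_0) \<Rightarrow> 'c fps" where
  "exp_series b = Abs_fps (\<lambda>n. b n / fact n)"

definition exp_coeff :: "'c::field_char_0 fps \<Rightarrow> nat \<Rightarrow> 'c" where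
  "exp_coeff G l = fact l * fps_nth G l"

text \<open>The arithmetic product of \<open>G 1, \<dots>, G k\<close>, the (multi)linear extension of
  \<open>x^n \<box> x^m = x^(n m)\<close> on the parts of positive degree. The constant coefficient of the result is
  \<open>0\<close>, because the index set of the sum is then empty; for positive \<open>l\<close> it is finite when
  \<open>k \<ge> 1\<close>.\<close>

definition fps_arith_prod :: "nat \<Rightarrow> (nat \<Rightarrow> 'c::comm_ring_1 fps) \<Rightarrow> 'c fps" where
  "fps_arith_prod k G =
     Abs_fps (\<lambda>l. \<Sum>d | d \<in> {1..k} \<rightarrow>\<^sub>E {1..} \<and> (\<Prod>i=1..k. d i) = l. \<Prod>i=1..k. fps_nth (G i) (d i))"

end

theory Submission
  imports Defs
begin

text \<open>The theorem rests on one identity between falling factorials. For numbers \<open>d 1, \<dots>, d k\<close> and a set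
  \<open>U\<close> with \<open>n\<close> elements, \<open>(d 1 \<cdots> d k)\<^sub>n\<close> counts the injections of \<open>U\<close> into a product of sets
  of sizes \<open>d 1, \<dots>, d k\<close>. Such a map has \<open>k\<close> coordinates, and it is injective exactly if the
  kernels of the coordinates, as partitions of \<open>U\<close>, meet in the partition into singletons, that is, form a
  partial rectangle \<open>\<pi>\<close>. A coordinate with kernel \<open>\<pi> i\<close> amounts to an injection of the set of blocks
  into a set of size \<open>d i\<close>. Therefore (\<open>falling_prod\<close>)
  \<open>(d 1 \<cdots> d k)\<^sub>n = (\<Sum>\<pi>. \<Prod>i. (d i)\<^sub>m)\<close> with \<open>m = |\<pi> i|\<close>, the sum being over the partial
  rectangles on \<open>U\<close>.

  Multiplying by \<open>\<Prod>i. b i (d i) / (d i)!\<close> and summing over all \<open>d\<close> turns the right-hand side into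
  \<open>\<Sum>\<pi>. \<Prod>i. |M i [\<pi> i]|\<close>, by the expansion of each \<open>M i\<close> in powers of \<open>x + 1\<close>; this is
  the number of structures of the modified arithmetic product on \<open>U\<close>. The interchange of product and sums needs
  absolute convergence, although the expansions are only assumed to converge. It comes for free because
  convergence is assumed at every order \<open>j\<close>: the terms of order \<open>j + 2\<close> are bounded and exceed those of
  order \<open>j\<close> by a factor that grows quadratically (\<open>expands_at_succ_norm_summable\<close>).

  The second form of the series is the first with the tuples \<open>d\<close> grouped by their product \<open>l\<close>. For
  \<open>n \<ge> 1\<close> the terms with \<open>l < n\<close> vanish, among them all those in which some \<open>d i\<close> is \<open>0\<close>, and for
  \<open>l \<ge> n\<close> the factor \<open>(l)\<^sub>n = l! / (l - n)!\<close> is common to the group. For \<open>n = 0\<close> tuples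
  with a zero entry contribute as well, and the arithmetic product does not see them; hence the separate constant
  term.\<close>

section \<open>Falling factorials count jointly injective families of maps\<close>

lemma falling_of_nat_eq_card_inj:
  assumes "finite A" "finite C"
  shows "falling (of_nat (card C) :: 'c::comm_ring_1) (card A) = of_nat (card {f \<in> A \<rightarrow>\<^sub>E C. inj_on f A})"
proof -
  have "falling (of_nat m :: 'c) n = of_nat (\<Prod>i\<in>{0..<n}. m - i)" for m n
  proof (cases "n \<le> m")
    case True
    then show ?thesis
      by (auto simp: falling_def of_nat_prod of_nat_diff atLeast0LessThan intro!: prod.cong)
  next
    case False
    then have "m \<in> {..<n}" by simp
    then have "(\<Prod>i<n. of_nat m - of_nat i :: 'c) = 0" "(\<Prod>i<n. m - i) = 0"
      by (rule prod_zero[OF finite_lessThan bexI[rotated]], simp)+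
    then show ?thesis by (simp only: falling_def atLeast0LessThan of_nat_0)
  qed
  then show ?thesis
    using card_inj_on_subset_funcset[OF assms order_refl] by simp
qed

definition kernel_partition :: "'a set \<Rightarrow> ('a \<Rightarrow> 'b) \<Rightarrow> 'a set set" where
  "kernel_partition U f = (\<lambda>u. {v \<in> U. f v = f u}) ` U"

lemma partition_on_kernel_partition: "partition_on U (kernel_partition U f)"
  by (rule partition_onI) (auto simp: kernel_partition_def disjnt_iff)

lemma same_kernel_block_iff:
  assumes "u \<in> U" "v \<in> U"
  shows "(\<exists>B\<in>kernel_partition U f. u \<in> B \<and> v \<in> B) \<longleftrightarrow> f u = f v"
  using assms by (auto simp: kernel_partition_def)

text \<open>A map with kernel \<open>P\<close> factors through the map from points to their blocks, and the induced map on
  blocks is injective.\<close>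

lemma card_maps_with_kernel:
  assumes P: "partition_on U P"
  shows "card {f \<in> U \<rightarrow>\<^sub>E C. kernel_partition U f = P} = card {g \<in> P \<rightarrow>\<^sub>E C. inj_on g P}"
proof -
  \<comment> \<open>\<open>\<beta>\<close> sends a point to its block, and \<open>\<rho>\<close> picks a representative of each block.\<close>
  have "\<forall>u\<in>U. \<exists>B\<in>P. u \<in> B" using partition_onD1[OF P] by auto
  then obtain \<beta> where \<beta>: "\<And>u. u \<in> U \<Longrightarrow> \<beta> u \<in> P \<and> u \<in> \<beta> u" by metis
  have "\<forall>B\<in>P. \<exists>u. u \<in> B" using partition_onD3[OF P] by (metis all_not_in_conv)
  then obtain \<rho> where \<rho>: "\<And>B. B \<in> P \<Longrightarrow> \<rho> B \<in> B" by metis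
  have sub: "u \<in> U" if "B \<in> P" "u \<in> B" for B u using that partition_onD1[OF P] by auto
  have uniq: "\<beta> u = B" if "B \<in> P" "u \<in> B" for B u
    using that \<beta>[OF sub[OF that]] partition_onD2[OF P] by (auto simp: disjoint_def)
  have "bij_betw (\<lambda>g. \<lambda>u\<in>U. g (\<beta> u)) {g \<in> P \<rightarrow>\<^sub>E C. inj_on g P}
          {f \<in> U \<rightarrow>\<^sub>E C. kernel_partition U f = P}"
  proof (rule bij_betw_byWitness[where f' = "\<lambda>f. \<lambda>B\<in>P. f (\<rho> B)"])
    show "\<forall>g\<in>{g \<in> P \<rightarrow>\<^sub>E C. inj_on g P}. (\<lambda>B\<in>P. (\<lambda>u\<in>U. g (\<beta> u)) (\<rho> B)) = g"
      using \<rho> sub uniq by (auto simp: fun_eq_iff PiE_def extensional_def)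
    have const: "f u = f v" if "kernel_partition U f = P" "B \<in> P" "u \<in> B" "v \<in> B" for f :: "'a \<Rightarrow> 'b" and B u v
      using that same_kernel_block_iff[of u U v f] sub by blast
    show "\<forall>f\<in>{f \<in> U \<rightarrow>\<^sub>E C. kernel_partition U f = P}. (\<lambda>u\<in>U. (\<lambda>B\<in>P. f (\<rho> B)) (\<beta> u)) = f"
    proof safe
      fix f assume f: "f \<in> U \<rightarrow>\<^sub>E C" "P = kernel_partition U f"
      have "f (\<rho> (\<beta> u)) = f u" if "u \<in> U" for u
        using const[of f "\<beta> u"] f \<beta>[OF that] \<rho> by blast
      then show "(\<lambda>u\<in>U. (\<lambda>B\<in>kernel_partition U f. f (\<rho> B)) (\<beta> u)) = f"
        using f \<beta> by (auto simp: fun_eq_iff PiE_def extensional_def)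
    qed
    show "(\<lambda>g. \<lambda>u\<in>U. g (\<beta> u)) ` {g \<in> P \<rightarrow>\<^sub>E C. inj_on g P}
            \<subseteq> {f \<in> U \<rightarrow>\<^sub>E C. kernel_partition U f = P}"
    proof safe
      fix g assume g: "g \<in> P \<rightarrow>\<^sub>E C" "inj_on g P"
      have same: "g (\<beta> v) = g (\<beta> u) \<longleftrightarrow> v \<in> \<beta> u" if "u \<in> U" "v \<in> U" for u v
        using \<beta> that uniq inj_on_eq_iff[OF g(2)] by metis
      have cls: "{v \<in> U. (\<lambda>u\<in>U. g (\<beta> u)) v = (\<lambda>u\<in>U. g (\<beta> u)) u} = \<beta> u" if u: "u \<in> U" for u
        using same[OF u] sub[OF conjunct1[OF \<beta>[OF u]]] u by auto
      have "kernel_partition U (\<lambda>u\<in>U. g (\<beta> u)) = \<beta> ` U"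
        unfolding kernel_partition_def by (rule image_cong[OF refl]) (rule cls)
      also have "\<dots> = P"
      proof (intro equalityI subsetI)
        fix B assume B: "B \<in> P"
        then show "B \<in> \<beta> ` U"
          using uniq[OF B \<rho>[OF B]] sub[OF B \<rho>[OF B]] by blast
      qed (use \<beta> in auto)
      finally have "kernel_partition U (\<lambda>u\<in>U. g (\<beta> u)) = P" .
      then show "x \<in> kernel_partition U (\<lambda>u\<in>U. g (\<beta> u)) \<Longrightarrow> x \<in> P"
        "x \<in> P \<Longrightarrow> x \<in> kernel_partition U (\<lambda>u\<in>U. g (\<beta> u))" for x by simp_all
    qed (use \<beta> in auto)
    show "(\<lambda>f. \<lambda>B\<in>P. f (\<rho> B)) ` {f \<in> U \<rightarrow>\<^sub>E C. kernel_partition U f = P}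
            \<subseteq> {g \<in> P \<rightarrow>\<^sub>E C. inj_on g P}"
    proof (rule image_subsetI, clarify, intro conjI)
      fix f assume f: "f \<in> U \<rightarrow>\<^sub>E C" "P = kernel_partition U f"
      show "(\<lambda>B\<in>kernel_partition U f. f (\<rho> B)) \<in> kernel_partition U f \<rightarrow>\<^sub>E C"
        using f \<rho> sub by auto
      have "A = B" if "A \<in> P" "B \<in> P" "f (\<rho> A) = f (\<rho> B)" for A B
        using that same_kernel_block_iff[of "\<rho> A" U "\<rho> B" f] f(2) \<rho> sub uniq by metis
      then show "inj_on (\<lambda>B\<in>kernel_partition U f. f (\<rho> B)) (kernel_partition U f)"
        using f(2) by (auto intro!: inj_onI)
    qed
  qed
  then show ?thesis by (simp add: bij_betw_same_card)
qed

lemma partial_rectangles_partition_on: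
  "\<pi> \<in> partial_rectangles k U \<Longrightarrow> i \<in> {1..k} \<Longrightarrow> partition_on U (\<pi> i)"
  using PiE_mem[of \<pi> "{1..k}" "\<lambda>_. {P. partition_on U P}" i] by (simp add: partial_rectangles_def)

lemma finite_partial_rectangles: "finite U \<Longrightarrow> finite (partial_rectangles k U)"
  by (rule finite_subset[of _ "{1..k} \<rightarrow>\<^sub>E {P. partition_on U P}"])
     (auto simp: partial_rectangles_def intro!: finite_PiE finitely_many_partition_on)

text \<open>The meet condition is used in this pointwise form: no two distinct points share a block in every coordinate.\<close>

lemma partial_rectangles_iff:
  assumes "k \<ge> 1"
  shows "\<pi> \<in> partial_rectangles k U \<longleftrightarrow>
    \<pi> \<in> {1..k} \<rightarrow>\<^sub>E {P. partition_on U P} \<and>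
    (\<forall>x\<in>U. \<forall>y\<in>U. (\<forall>i\<in>{1..k}. \<exists>B\<in>\<pi> i. x \<in> B \<and> y \<in> B) \<longrightarrow> x = y)"
proof (cases "\<pi> \<in> {1..k} \<rightarrow>\<^sub>E {P. partition_on U P}")
  case True
  then have "\<And>i. i \<in> {1..k} \<Longrightarrow> partition_on U (\<pi> i)" by auto
  from common_refinement_singletons_iff[OF assms this] True show ?thesis
    by (simp add: partial_rectangles_def)
qed (simp add: partial_rectangles_def)

text \<open>Sort the injections into a product by the kernels of their \<open>k\<close> coordinates. Joint injectivity says
  that these kernels form a partial rectangle, and once the kernels are fixed the coordinates can be chosen
  independently of each other.\<close>

lemma card_jointly_injective:
  assumes k: "k \<ge> 1" and U: "finite U" and C: "\<And>i. i \<in> {1..k} \<Longrightarrow> finite (C i)"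
  shows "card {f \<in> U \<rightarrow>\<^sub>E (\<Pi>\<^sub>E i\<in>{1..k}. C i). inj_on f U} =
    (\<Sum>\<pi>\<in>partial_rectangles k U. \<Prod>i=1..k. card {g \<in> \<pi> i \<rightarrow>\<^sub>E C i. inj_on g (\<pi> i)})"
proof -
  let ?J = "{f \<in> U \<rightarrow>\<^sub>E (\<Pi>\<^sub>E i\<in>{1..k}. C i). inj_on f U}"
  let ?K = "\<lambda>\<pi>. \<Pi>\<^sub>E i\<in>{1..k}. {f \<in> U \<rightarrow>\<^sub>E C i. kernel_partition U f = \<pi> i}"
  have "bij_betw (\<lambda>f. \<lambda>i\<in>{1..k}. \<lambda>u\<in>U. f u i) ?J (\<Union>\<pi>\<in>partial_rectangles k U. ?K \<pi>)"
  proof (rule bij_betw_byWitness[where f' = "\<lambda>h. \<lambda>u\<in>U. \<lambda>i\<in>{1..k}. h i u"])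
    show "\<forall>f\<in>?J. (\<lambda>u\<in>U. \<lambda>i\<in>{1..k}. (\<lambda>i\<in>{1..k}. \<lambda>u\<in>U. f u i) i u) = f"
      by (auto simp: fun_eq_iff PiE_def extensional_def Pi_def)
    show "\<forall>h\<in>\<Union>\<pi>\<in>partial_rectangles k U. ?K \<pi>. (\<lambda>i\<in>{1..k}. \<lambda>u\<in>U. (\<lambda>u\<in>U. \<lambda>i\<in>{1..k}. h i u) u i) = h"
      by (fastforce simp: fun_eq_iff PiE_def extensional_def Pi_def)
    show "(\<lambda>f. \<lambda>i\<in>{1..k}. \<lambda>u\<in>U. f u i) ` ?J \<subseteq> (\<Union>\<pi>\<in>partial_rectangles k U. ?K \<pi>)"
    proof (rule image_subsetI)
      fix f assume f: "f \<in> ?J"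
      let ?\<pi> = "\<lambda>i\<in>{1..k}. kernel_partition U (\<lambda>u\<in>U. f u i)"
      have "x = y" if xy: "x \<in> U" "y \<in> U" and tog: "\<forall>i\<in>{1..k}. \<exists>B\<in>?\<pi> i. x \<in> B \<and> y \<in> B" for x y
      proof -
        have "f x i = f y i" if i: "i \<in> {1..k}" for i
          using tog i xy same_kernel_block_iff[of x U y "\<lambda>u\<in>U. f u i"] by auto
        moreover have "f x \<in> extensional {1..k}" "f y \<in> extensional {1..k}"
          using f xy by (auto simp: PiE_def)
        ultimately have "f x = f y" by (intro extensionalityI)
        then show ?thesis using f xy by (auto dest: inj_onD)
      qed
      then have "?\<pi> \<in> partial_rectangles k U"
        unfolding partial_rectangles_iff[OF k] using partition_on_kernel_partition by auto
      moreover have "(\<lambda>i\<in>{1..k}. \<lambda>u\<in>U. f u i) \<in> ?K ?\<pi>"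
        using f by (auto simp: PiE_def Pi_def)
      ultimately show "(\<lambda>i\<in>{1..k}. \<lambda>u\<in>U. f u i) \<in> (\<Union>\<pi>\<in>partial_rectangles k U. ?K \<pi>)" by blast
    qed
    show "(\<lambda>h. \<lambda>u\<in>U. \<lambda>i\<in>{1..k}. h i u) ` (\<Union>\<pi>\<in>partial_rectangles k U. ?K \<pi>) \<subseteq> ?J"
    proof (rule image_subsetI)
      fix h assume "h \<in> (\<Union>\<pi>\<in>partial_rectangles k U. ?K \<pi>)"
      then obtain \<pi> where \<pi>: "\<pi> \<in> partial_rectangles k U" and h: "h \<in> ?K \<pi>" by blast
      have "(\<lambda>u\<in>U. \<lambda>i\<in>{1..k}. h i u) \<in> U \<rightarrow>\<^sub>E (\<Pi>\<^sub>E i\<in>{1..k}. C i)"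
        using h by (fastforce simp: PiE_def Pi_def)
      moreover have "inj_on (\<lambda>u\<in>U. \<lambda>i\<in>{1..k}. h i u) U"
      proof (rule inj_onI)
        fix x y assume xy: "x \<in> U" "y \<in> U"
          and eq: "(\<lambda>u\<in>U. \<lambda>i\<in>{1..k}. h i u) x = (\<lambda>u\<in>U. \<lambda>i\<in>{1..k}. h i u) y"
        have "\<exists>B\<in>\<pi> i. x \<in> B \<and> y \<in> B" if i: "i \<in> {1..k}" for i
        proof -
          have "h i x = h i y" using fun_cong[OF eq, of i] xy i by simp
          moreover have "kernel_partition U (h i) = \<pi> i" using PiE_mem[OF h i] by simp
          ultimately show ?thesis using same_kernel_block_iff[OF xy, of "h i"] by simp
        qed
        then show "x = y" using \<pi> xy unfolding partial_rectangles_iff[OF k] by blast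
      qed
      ultimately show "(\<lambda>u\<in>U. \<lambda>i\<in>{1..k}. h i u) \<in> ?J" by simp
    qed
  qed
  then have "card ?J = card (\<Union>\<pi>\<in>partial_rectangles k U. ?K \<pi>)" by (rule bij_betw_same_card)
  also have "\<dots> = (\<Sum>\<pi>\<in>partial_rectangles k U. card (?K \<pi>))"
  proof (rule card_UN_disjoint)
    show "finite (partial_rectangles k U)" by (rule finite_partial_rectangles[OF U])
    show "\<forall>\<pi>\<in>partial_rectangles k U. finite (?K \<pi>)"
    proof (intro ballI finite_PiE)
      fix \<pi> i assume "i \<in> {1..k}"
      then have "finite (U \<rightarrow>\<^sub>E C i)" using U C by (intro finite_PiE) auto
      then show "finite {f \<in> U \<rightarrow>\<^sub>E C i. kernel_partition U f = \<pi> i}"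
        by (rule rev_finite_subset) auto
    qed simp
    show "\<forall>\<pi>\<in>partial_rectangles k U. \<forall>\<pi>'\<in>partial_rectangles k U. \<pi> \<noteq> \<pi>' \<longrightarrow> ?K \<pi> \<inter> ?K \<pi>' = {}"
    proof (intro ballI impI equals0I)
      fix \<pi> \<pi>' h assume \<pi>: "\<pi> \<in> partial_rectangles k U" "\<pi>' \<in> partial_rectangles k U" "\<pi> \<noteq> \<pi>'"
        and h: "h \<in> ?K \<pi> \<inter> ?K \<pi>'"
      have "\<pi> i = \<pi>' i" if i: "i \<in> {1..k}" for i
        using h PiE_mem[of h _ _ i] i by blast
      moreover have "\<pi> \<in> extensional {1..k}" "\<pi>' \<in> extensional {1..k}"
        using \<pi> by (auto simp: partial_rectangles_def PiE_def)
      ultimately show False using \<pi>(3) extensionalityI by metis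
    qed
  qed
  also have "\<dots> = (\<Sum>\<pi>\<in>partial_rectangles k U. \<Prod>i=1..k. card {g \<in> \<pi> i \<rightarrow>\<^sub>E C i. inj_on g (\<pi> i)})"
  proof (rule sum.cong[OF refl])
    fix \<pi> assume "\<pi> \<in> partial_rectangles k U"
    then have "partition_on U (\<pi> i)" if "i \<in> {1..k}" for i
      using that by (intro partial_rectangles_partition_on)
    then show "card (?K \<pi>) = (\<Prod>i=1..k. card {g \<in> \<pi> i \<rightarrow>\<^sub>E C i. inj_on g (\<pi> i)})"
      by (simp add: card_PiE card_maps_with_kernel)
  qed
  finally show ?thesis .
qed

text \<open>Both sides count the injections of \<open>U\<close> into \<open>\<Pi>\<^sub>E i\<in>{1..k}. {..<d i}\<close>.\<close>

lemma falling_prod: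
  assumes k: "k \<ge> 1" and U: "finite U"
  shows "falling (of_nat (\<Prod>i=1..k. d i) :: 'c::comm_ring_1) (card U) =
    (\<Sum>\<pi>\<in>partial_rectangles k U. \<Prod>i=1..k. falling (of_nat (d i)) (card (\<pi> i)))"
proof -
  let ?C = "\<lambda>i. {..<d i}"
  have fin: "finite (\<pi> i)" if "\<pi> \<in> partial_rectangles k U" "i \<in> {1..k}" for \<pi> i
    using finite_elements[OF U partial_rectangles_partition_on[OF that]] .
  have "falling (of_nat (\<Prod>i=1..k. d i) :: 'c) (card U) =
      falling (of_nat (card (\<Pi>\<^sub>E i\<in>{1..k}. ?C i))) (card U)"
    by (simp add: card_PiE)
  also have "\<dots> = of_nat (card {f \<in> U \<rightarrow>\<^sub>E (\<Pi>\<^sub>E i\<in>{1..k}. ?C i). inj_on f U})"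
    by (intro falling_of_nat_eq_card_inj U finite_PiE) auto
  also have "\<dots> = (\<Sum>\<pi>\<in>partial_rectangles k U.
      \<Prod>i=1..k. of_nat (card {g \<in> \<pi> i \<rightarrow>\<^sub>E ?C i. inj_on g (\<pi> i)}))"
    by (subst card_jointly_injective[OF k U]) (auto simp: of_nat_sum of_nat_prod)
  also have "\<dots> = (\<Sum>\<pi>\<in>partial_rectangles k U. \<Prod>i=1..k. falling (of_nat (d i)) (card (\<pi> i)))"
  proof (intro sum.cong prod.cong refl)
    show "of_nat (card {g \<in> \<pi> i \<rightarrow>\<^sub>E ?C i. inj_on g (\<pi> i)}) = (falling (of_nat (d i)) (card (\<pi> i)) :: 'c)"
      if "\<pi> \<in> partial_rectangles k U" "i \<in> {1..k}" for \<pi> i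
      using falling_of_nat_eq_card_inj[where ?'c = 'c, OF fin[OF that], of "?C i"] by simp
  qed
  finally show ?thesis .
qed

section \<open>Counting structures of the modified arithmetic product\<close>

lemma card_structs_initial_labels:
  assumes "is_species F" "finite V"
  shows "card (structs F V) = card (structs F (initial_labels (card V)))"
proof -
  have "card (initial_labels (card V)) = card V"
    by (simp add: initial_labels_def card_image inj_on_def)
  then obtain \<sigma> where "bij_betw \<sigma> V (initial_labels (card V))"
    using assms(2) finite_same_card_bij[of V "initial_labels (card V)"]
    by (auto simp: initial_labels_def)
  then show ?thesis by (metis assms bij_betw_same_card is_species_bij)
qed

lemma card_block_labels:
  assumes "finite U" "partition_on U P"
  shows "card (block_labels P) = card P"
proof -
  have "finite B" if "B \<in> P" for B
    using that assms partition_onD1 by (metis Sup_upper finite_subset)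
  then show ?thesis
    unfolding block_labels_def by (intro card_image inj_onI) (simp add: Abs_fset_inject)
qed

lemma card_structs_mod_arith_prod:
  assumes U: "finite U" and M: "\<And>i. i \<in> {1..k} \<Longrightarrow> is_species (M i)"
  shows "card (structs (mod_arith_prod k M) U) =
    (\<Sum>\<pi>\<in>partial_rectangles k U. \<Prod>i=1..k. card (structs (M i) (initial_labels (card (\<pi> i)))))"
proof -
  have part: "partition_on U (\<pi> i)" if "\<pi> \<in> partial_rectangles k U" "i \<in> {1..k}" for \<pi> i
    using that by (rule partial_rectangles_partition_on)
  have fin: "finite (block_labels (\<pi> i))" if "\<pi> \<in> partial_rectangles k U" "i \<in> {1..k}" for \<pi> i
    using finite_elements[OF U part[OF that]] by (simp add: block_labels_def)
  have "card (structs (M i) (block_labels (\<pi> i))) = card (structs (M i) (initial_labels (card (\<pi> i))))"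
    if "\<pi> \<in> partial_rectangles k U" "i \<in> {1..k}" for \<pi> i
    using card_structs_initial_labels[OF M fin] card_block_labels[OF U part] that by simp
  moreover have "finite (structs (M i) (block_labels (\<pi> i)))"
    if "\<pi> \<in> partial_rectangles k U" "i \<in> {1..k}" for \<pi> i
    using is_species_finite[OF M fin] that by blast
  then have "card (structs (mod_arith_prod k M) U) =
      (\<Sum>\<pi>\<in>partial_rectangles k U. card (\<Pi>\<^sub>E i\<in>{1..k}. structs (M i) (block_labels (\<pi> i))))"
    unfolding mod_arith_prod_def species.simps
    by (intro card_SigmaI finite_partial_rectangles[OF U] ballI finite_PiE) auto
  ultimately show ?thesis by (simp add: card_PiE)
qed

lemma card_structs_mod_arith_prod_empty:
  assumes "k \<ge> 1"
  shows "card (structs (mod_arith_prod k M) {}) = (\<Prod>i=1..k. card (structs (M i) {}))"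
proof -
  have "partial_rectangles k ({} :: label set) = {\<lambda>i\<in>{1..k}. {}}"
  proof (intro equalityI subsetI)
    fix \<pi> :: "nat \<Rightarrow> label set set" assume \<pi>: "\<pi> \<in> partial_rectangles k {}"
    have "\<pi> i = {}" if "i \<in> {1..k}" for i
      using partial_rectangles_partition_on[OF \<pi> that] by (simp add: partition_on_empty)
    moreover have "\<pi> \<in> extensional {1..k}"
      using \<pi> by (simp add: partial_rectangles_def PiE_def)
    ultimately have "\<pi> = (\<lambda>i\<in>{1..k}. {})" by (intro extensionalityI[of _ "{1..k}"]) auto
    then show "\<pi> \<in> {\<lambda>i\<in>{1..k}. {}}" by simp
  next
    fix \<pi> :: "nat \<Rightarrow> label set set" assume "\<pi> \<in> {\<lambda>i\<in>{1..k}. {}}"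
    then show "\<pi> \<in> partial_rectangles k {}"
      by (simp add: partial_rectangles_iff[OF assms] partition_on_empty)
  qed
  moreover have "(\<Pi>\<^sub>E i\<in>{1..k}. structs (M i) (block_labels ((\<lambda>i\<in>{1..k}. {}) i))) =
      (\<Pi>\<^sub>E i\<in>{1..k}. structs (M i) {})"
    by (rule PiE_cong) (simp add: block_labels_def)
  ultimately have "structs (mod_arith_prod k M) {} =
      {\<lambda>i\<in>{1..k}. {}} \<times> (\<Pi>\<^sub>E i\<in>{1..k}. structs (M i) {})"
    by (simp only: mod_arith_prod_def species.simps Sigma_def UN_insert UN_empty)
  then show ?thesis by (simp add: card_cartesian_product_singleton card_PiE)
qed

section \<open>Absolute convergence\<close>

lemma falling_Suc: "falling x (Suc n) = falling x n * (x - of_nat n)"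
  by (simp add: falling_def)

lemma falling_of_nat_eq_0: "m < n \<Longrightarrow> falling (of_nat m :: 'c::comm_ring_1) n = 0"
  unfolding falling_def by (intro prod_zero) auto

text \<open>The terms \<open>t (j + 2) m\<close> of order \<open>j + 2\<close> tend to \<open>0\<close> in \<open>m\<close>, hence are bounded by some \<open>K\<close>, and
  \<open>t (j + 2) m = t j m * (m - j) * (m - j - 1)\<close>. So \<open>t j m\<close> is dominated by a multiple of
  \<open>1 / (m - j - 1)\<^sup>2\<close> as soon as \<open>m \<ge> j + 2\<close>.\<close>

lemma expands_at_succ_norm_summable:
  fixes b :: "nat \<Rightarrow> 'c::real_normed_field"
  assumes "expands_at_succ F b"
  shows "summable (\<lambda>n. norm (b n * falling (of_nat n) j / fact n))"
proof -
  let ?t = "\<lambda>j n. b n * falling (of_nat n) j / fact n"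
  have "summable (?t (j + 2))"
    using assms by (auto simp: expands_at_succ_def sums_iff)
  then have "Bseq (?t (j + 2))"
    by (intro convergent_imp_Bseq convergentI[of _ 0] summable_LIMSEQ_zero)
  then obtain K where K: "\<And>n. norm (?t (j + 2) n) \<le> K" by (auto simp: Bseq_def)
  have bound: "norm (?t j (n + (j + 2))) \<le> K * inverse (of_nat (Suc n) ^ 2)" for n
  proof -
    let ?m = "n + (j + 2)"
    have "?t (j + 2) ?m = ?t j ?m * (of_nat (Suc (Suc n)) * of_nat (Suc n))"
      by (simp add: falling_Suc algebra_simps)
    then have "norm (?t j ?m) * (real (Suc (Suc n)) * real (Suc n)) = norm (?t (j + 2) ?m)"
      by (simp only: norm_mult norm_of_nat)
    also have "\<dots> \<le> K" by (rule K)
    finally have "norm (?t j ?m) * (real (Suc (Suc n)) * real (Suc n)) \<le> K" .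
    moreover have "norm (?t j ?m) * (real (Suc n) * real (Suc n)) \<le>
        norm (?t j ?m) * (real (Suc (Suc n)) * real (Suc n))"
      by (intro mult_left_mono mult_right_mono) auto
    ultimately have "norm (?t j ?m) * (real (Suc n) ^ 2) \<le> K"
      by (simp add: power2_eq_square)
    then show ?thesis by (simp add: field_simps del: of_nat_Suc)
  qed
  have "summable (\<lambda>n. K * inverse (real (Suc n) ^ 2))"
    using inverse_power_summable[of 2, where ?'a = real]
    by (intro summable_mult) (subst summable_Suc_iff, simp)
  then have "summable (\<lambda>n. norm (?t j (n + (j + 2))))"
    by (rule summable_comparison_test'[where N = 0])
       (simp only: real_norm_def abs_norm_cancel bound)
  then show ?thesis by (rule summable_iff_shift[THEN iffD1])
qed

text \<open>Every finite partial sum of the norms lies inside a finite box, where the sum factorises and is bounded by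
  the product of the sums of the norms.\<close>

lemma has_sum_prod_PiE:
  fixes f :: "'i \<Rightarrow> 'b \<Rightarrow> 'c::{real_normed_field, banach}"
  assumes A: "finite A" and f: "\<And>i. i \<in> A \<Longrightarrow> f i abs_summable_on B i"
    and s: "\<And>i. i \<in> A \<Longrightarrow> (f i has_sum s i) (B i)"
  shows "((\<lambda>g. \<Prod>i\<in>A. f i (g i)) has_sum (\<Prod>i\<in>A. s i)) (PiE A B)"
proof -
  have "(\<lambda>g. \<Prod>i\<in>A. norm (f i (g i))) summable_on PiE A B"
  proof (rule nonneg_bdd_above_summable_on)
    have "sum (\<lambda>g. \<Prod>i\<in>A. norm (f i (g i))) X \<le> (\<Prod>i\<in>A. \<Sum>\<^sub>\<infinity>x\<in>B i. norm (f i x))"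
      if X: "X \<subseteq> PiE A B" "finite X" for X
    proof -
      let ?Y = "\<lambda>i. (\<lambda>g. g i) ` X"
      have "X \<subseteq> PiE A ?Y" using X by (auto simp: PiE_def)
      then have "sum (\<lambda>g. \<Prod>i\<in>A. norm (f i (g i))) X \<le> sum (\<lambda>g. \<Prod>i\<in>A. norm (f i (g i))) (PiE A ?Y)"
        using A X by (intro sum_mono2 finite_PiE prod_nonneg) auto
      also have "\<dots> = (\<Prod>i\<in>A. \<Sum>x\<in>?Y i. norm (f i x))"
        using A X by (intro prod_sum_PiE[symmetric]) auto
      also have "\<dots> \<le> (\<Prod>i\<in>A. \<Sum>\<^sub>\<infinity>x\<in>B i. norm (f i x))"
        using f X by (intro prod_mono conjI sum_nonneg finite_sum_le_infsum) (auto simp: PiE_iff)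
      finally show ?thesis .
    qed
    then show "bdd_above (sum (\<lambda>g. \<Prod>i\<in>A. norm (f i (g i))) ` {X. X \<subseteq> PiE A B \<and> finite X})"
      by (intro bdd_aboveI2) auto
  qed (auto intro: prod_nonneg)
  then have "(\<lambda>g. \<Prod>i\<in>A. f i (g i)) abs_summable_on PiE A B" by (simp only: prod_norm)
  then have "(\<lambda>g. \<Prod>i\<in>A. f i (g i)) summable_on PiE A B" by (rule abs_summable_summable)
  moreover have "infsum (\<lambda>g. \<Prod>i\<in>A. f i (g i)) (PiE A B) = (\<Prod>i\<in>A. s i)"
    using infsum_prod_PiE_abs[OF A f] infsumI[OF s] by simp
  ultimately show ?thesis by (metis has_sum_infsum)
qed

lemma has_sum_finite_sum:
  fixes f :: "'i \<Rightarrow> 'b \<Rightarrow> 'c::topological_comm_monoid_add"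
  assumes "finite I" "\<And>i. i \<in> I \<Longrightarrow> (f i has_sum s i) A"
  shows "((\<lambda>x. \<Sum>i\<in>I. f i x) has_sum (\<Sum>i\<in>I. s i)) A"
  using assms by (induction I rule: finite_induct) (auto intro: has_sum_add)

lemma expands_at_succ_has_sum:
  fixes b :: "nat \<Rightarrow> 'c::{real_normed_field, banach}"
  assumes "expands_at_succ F b"
  shows "((\<lambda>n. b n * falling (of_nat n) j / fact n) has_sum of_nat (card (structs F (initial_labels j)))) UNIV"
  using assms expands_at_succ_norm_summable[OF assms]
  by (intro norm_summable_imp_has_sum) (auto simp: expands_at_succ_def)

text \<open>By \<open>falling_prod\<close> the multiple series is a finite sum, over the partial rectangles, of products of
  absolutely convergent simple series.\<close>

lemma has_sum_card_structs_mod_arith_prod: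
  fixes b :: "nat \<Rightarrow> nat \<Rightarrow> 'c::{real_normed_field, banach}"
  assumes k: "k \<ge> 1"
    and M: "\<And>i. i \<in> {1..k} \<Longrightarrow> is_species (M i)"
    and b: "\<And>i. i \<in> {1..k} \<Longrightarrow> expands_at_succ (M i) (b i)"
    and U: "finite U"
  shows "((\<lambda>d. (\<Prod>i=1..k. b i (d i)) * falling (of_nat (\<Prod>i=1..k. d i)) (card U) / (\<Prod>i=1..k. fact (d i)))
           has_sum of_nat (card (structs (mod_arith_prod k M) U))) ({1..k} \<rightarrow>\<^sub>E UNIV)"
proof -
  have "((\<lambda>d. \<Sum>\<pi>\<in>partial_rectangles k U. \<Prod>i=1..k. b i (d i) * falling (of_nat (d i)) (card (\<pi> i)) / fact (d i))
      has_sum (\<Sum>\<pi>\<in>partial_rectangles k U. \<Prod>i=1..k. of_nat (card (structs (M i) (initial_labels (card (\<pi> i)))))))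
      ({1..k} \<rightarrow>\<^sub>E UNIV)"
  proof (intro has_sum_finite_sum finite_partial_rectangles[OF U])
    fix \<pi> assume "\<pi> \<in> partial_rectangles k U"
    have "(\<lambda>n. b i n * falling (of_nat n) (card (\<pi> i)) / fact n) abs_summable_on UNIV"
      if "i \<in> {1..k}" for i
      using expands_at_succ_norm_summable[OF b[OF that]]
      by (intro norm_summable_imp_summable_on) simp
    then show "((\<lambda>d. \<Prod>i=1..k. b i (d i) * falling (of_nat (d i)) (card (\<pi> i)) / fact (d i)) has_sum
        (\<Prod>i=1..k. of_nat (card (structs (M i) (initial_labels (card (\<pi> i))))))) ({1..k} \<rightarrow>\<^sub>E UNIV)"
      by (intro has_sum_prod_PiE[where f = "\<lambda>i n. b i n * falling (of_nat n) (card (\<pi> i)) / fact n"]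
          finite_atLeastAtMost expands_at_succ_has_sum[OF b])
  qed
  moreover have "(\<Sum>\<pi>\<in>partial_rectangles k U. \<Prod>i=1..k. b i (d i) * falling (of_nat (d i)) (card (\<pi> i)) / fact (d i)) =
      (\<Prod>i=1..k. b i (d i)) * falling (of_nat (\<Prod>i=1..k. d i)) (card U) / (\<Prod>i=1..k. fact (d i))" for d
    unfolding falling_prod[OF k U]
    by (simp only: prod_dividef prod.distrib sum_distrib_left sum_divide_distrib)
  moreover have "card (structs (mod_arith_prod k M) U) =
      (\<Sum>\<pi>\<in>partial_rectangles k U. \<Prod>i=1..k. card (structs (M i) (initial_labels (card (\<pi> i)))))"
    using U M by (rule card_structs_mod_arith_prod)
  ultimately show ?thesis by (simp only: of_nat_sum of_nat_prod)
qed

section \<open>Grouping the multiple series by products\<close>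

lemma finite_factorisations:
  fixes k l :: nat
  assumes "l \<ge> 1"
  shows "finite {d \<in> {1..k} \<rightarrow>\<^sub>E {1..}. (\<Prod>i=1..k. d i) = l}"
proof (rule finite_subset)
  show "{d \<in> {1..k} \<rightarrow>\<^sub>E {1..}. (\<Prod>i=1..k. d i) = l} \<subseteq> {1..k} \<rightarrow>\<^sub>E {..l}"
  proof
    fix d assume d: "d \<in> {d \<in> {1..k} \<rightarrow>\<^sub>E {1..}. (\<Prod>i=1..k. d i) = l}"
    have "d i \<le> l" if "i \<in> {1..k}" for i
      using d that assms by (intro dvd_imp_le) (auto intro!: dvd_prodI)
    then show "d \<in> {1..k} \<rightarrow>\<^sub>E {..l}" using d by (auto simp: PiE_iff)
  qed
  show "finite ({1..k} \<rightarrow>\<^sub>E {..l})" by (intro finite_PiE) auto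
qed

lemma falling_of_nat_eq_fact_div:
  assumes "n \<le> l"
  shows "falling (of_nat l :: 'c::field_char_0) n = fact l / fact (l - n)"
  using assms
proof (induction n)
  case 0
  then show ?case by (simp add: falling_def)
next
  case (Suc n)
  then have "l - n = Suc (l - Suc n)" by simp
  then have "fact (l - n) = (of_nat l - of_nat n) * (fact (l - Suc n) :: 'c)"
    using Suc.prems by (metis Suc_leD fact_Suc of_nat_diff)
  moreover have "(of_nat l - of_nat n :: 'c) \<noteq> 0"
    using Suc.prems by simp
  moreover have "falling (of_nat l :: 'c) n = fact l / fact (l - n)"
    using Suc by simp
  ultimately show ?case by (simp add: falling_Suc)
qed

text \<open>For \<open>n \<ge> 1\<close> only tuples with product at least \<open>n\<close> contribute. These have positive entries, so they
  are exactly the factorisations indexing the coefficients of the arithmetic product.\<close>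

lemma has_sum_group_by_product:
  fixes b :: "nat \<Rightarrow> nat \<Rightarrow> 'c::{real_normed_field, banach}"
  assumes n: "n \<ge> 1"
    and sum: "((\<lambda>d. (\<Prod>i=1..k. b i (d i)) * falling (of_nat (\<Prod>i=1..k. d i)) n / (\<Prod>i=1..k. fact (d i)))
           has_sum s) ({1..k} \<rightarrow>\<^sub>E UNIV)"
  shows "((\<lambda>l. exp_coeff (fps_arith_prod k (\<lambda>i. exp_series (b i))) l / fact (l - n)) has_sum s) {n..}"
proof -
  let ?S = "\<lambda>d. (\<Prod>i=1..k. b i (d i)) * falling (of_nat (\<Prod>i=1..k. d i)) n / (\<Prod>i=1..k. fact (d i))"
  let ?p = "\<lambda>d :: nat \<Rightarrow> nat. \<Prod>i=1..k. d i"
  let ?D = "{d \<in> {1..k} \<rightarrow>\<^sub>E UNIV. ?p d \<ge> n}"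
  let ?fib = "\<lambda>l. {d \<in> {1..k} \<rightarrow>\<^sub>E {1..}. ?p d = l}"
  have "(?S has_sum s) ?D"
  proof (rule has_sum_cong_neutral[THEN iffD1, OF _ _ _ sum])
    fix d assume "d \<in> ({1..k} \<rightarrow>\<^sub>E UNIV) - ?D"
    then have "?p d < n" by auto
    then show "?S d = 0" by (simp only: falling_of_nat_eq_0) simp
  qed auto
  moreover have "bij_betw snd (Sigma {n..} ?fib) ?D"
  proof (rule bij_betw_byWitness[where f' = "\<lambda>d. (?p d, d)"])
    have "d \<in> {1..k} \<rightarrow>\<^sub>E {1..}" if d: "d \<in> ?D" for d
    proof -
      have "?p d \<ge> n" using d by blast
      then have "?p d \<noteq> 0" using n by linarith
      then have pos: "d i \<noteq> 0" if "i \<in> {1..k}" for i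
        using that by (metis finite_atLeastAtMost prod_zero)
      have "d i \<in> {1..}" if "i \<in> {1..k}" for i using pos[OF that] by simp
      then show ?thesis using d by (simp add: PiE_iff)
    qed
    then show "(\<lambda>d. (?p d, d)) ` ?D \<subseteq> Sigma {n..} ?fib" by auto
  qed (auto simp: PiE_iff)
  ultimately have "((\<lambda>x. ?S (snd x)) has_sum s) (Sigma {n..} ?fib)"
    by (simp only: has_sum_reindex_bij_betw[of snd _ _ ?S])
  then show ?thesis
  proof (rule has_sum_SigmaD)
    fix l assume l: "l \<in> {n..}"
    have "?S d = fact l / fact (l - n) * (\<Prod>i=1..k. fps_nth (exp_series (b i)) (d i))" if "d \<in> ?fib l" for d
    proof -
      have "?p d = l" using that by simp
      then have "?S d = (\<Prod>i=1..k. b i (d i)) * falling (of_nat l) n / (\<Prod>i=1..k. fact (d i))"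
        by (simp only:)
      also have "\<dots> = fact l / fact (l - n) * (\<Prod>i=1..k. fps_nth (exp_series (b i)) (d i))"
        using l by (simp add: falling_of_nat_eq_fact_div exp_series_def prod_dividef)
      finally show ?thesis .
    qed
    then have "sum ?S (?fib l) = exp_coeff (fps_arith_prod k (\<lambda>i. exp_series (b i))) l / fact (l - n)"
      by (simp add: exp_coeff_def fps_arith_prod_def sum_distrib_left sum_divide_distrib)
    then show "((\<lambda>d. ?S (snd (l, d))) has_sum
        exp_coeff (fps_arith_prod k (\<lambda>i. exp_series (b i))) l / fact (l - n)) (?fib l)"
      using l n finite_factorisations[of l k] by (intro has_sum_finiteI) auto
  qed
qed

section \<open>The generating series\<close>

theorem theorem5p5:
  fixes k :: nat
    and M :: "nat \<Rightarrow> 's species"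
    and b :: "nat \<Rightarrow> nat \<Rightarrow> 'c :: {real_normed_field, banach}"
  assumes "k \<ge> 1"
    and "\<And>i. i \<in> {1..k} \<Longrightarrow> is_species (M i)"
    and "\<And>i. i \<in> {1..k} \<Longrightarrow> expands_at_succ (M i) (b i)"
  defines "S \<equiv> (\<lambda>n d. (\<Prod>i=1..k. b i (d i)) * falling (of_nat (\<Prod>i=1..k. d i)) n /
                        (\<Prod>i=1..k. fact (d i)))"
    and "T \<equiv> (\<lambda>n l. exp_coeff (fps_arith_prod k (\<lambda>i. exp_series (b i))) l / fact (l - n))"
    and "a\<^sub>0 \<equiv> card (structs (mod_arith_prod k M) {})"
  shows "(\<forall>n. S n summable_on ({1..k} \<rightarrow>\<^sub>E UNIV)) \<and>
         egf (mod_arith_prod k M) =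
           Abs_fps (\<lambda>n. (\<Sum>\<^sub>\<infinity>d \<in> {1..k} \<rightarrow>\<^sub>E UNIV. S n d) / fact n) \<and>
         (\<forall>n\<ge>1. T n summable_on {n..}) \<and>
         egf (mod_arith_prod k M) =
           fps_const (of_nat a\<^sub>0) +
           Abs_fps (\<lambda>n. if n \<ge> 1 then (\<Sum>\<^sub>\<infinity>l \<in> {n..}. T n l) / fact n else 0) \<and>
         a\<^sub>0 = (\<Prod>i=1..k. card (structs (M i) {}))"
proof -
  let ?a = "\<lambda>n. of_nat (card (structs (mod_arith_prod k M) (initial_labels n))) :: 'c"
  have "finite (initial_labels n)" "card (initial_labels n) = n" for n
    by (simp_all add: initial_labels_def card_image inj_on_def)
  then have S: "(S n has_sum ?a n) ({1..k} \<rightarrow>\<^sub>E UNIV)" for n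
    using has_sum_card_structs_mod_arith_prod[OF assms(1-3), where U = "initial_labels n"]
    by (simp add: S_def)
  then have T: "(T n has_sum ?a n) {n..}" if "n \<ge> 1" for n
    using has_sum_group_by_product[OF that S[unfolded S_def]] by (simp only: T_def)
  have "?a 0 = of_nat a\<^sub>0" by (simp add: a\<^sub>0_def initial_labels_def)
  then have "egf (mod_arith_prod k M) = fps_const (of_nat a\<^sub>0) +
      Abs_fps (\<lambda>n. if n \<ge> 1 then (\<Sum>\<^sub>\<infinity>l \<in> {n..}. T n l) / fact n else 0)"
    using infsumI[OF T] by (auto simp: egf_def fps_eq_iff Suc_le_eq)
  moreover have "egf (mod_arith_prod k M) = Abs_fps (\<lambda>n. (\<Sum>\<^sub>\<infinity>d \<in> {1..k} \<rightarrow>\<^sub>E UNIV. S n d) / fact n)"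
    using infsumI[OF S] by (simp add: egf_def)
  moreover have "a\<^sub>0 = (\<Prod>i=1..k. card (structs (M i) {}))"
    unfolding a\<^sub>0_def by (rule card_structs_mod_arith_prod_empty[OF assms(1)])
  ultimately show ?thesis
    using has_sum_imp_summable[OF S] has_sum_imp_summable[OF T] by blast
qed

end
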